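(* Let $f$ be a non-linear metric $f(R)$ gravity model, i.e. $f''(R)\neq 0$. No vacuum exterior metric of the form $$ds^2_+=U(t,r)\,V(r)\,dt^2-V^{-1}(r)\,dr^2-r^2d\Omega_{(2)}^2$$ can be smoothly matched, in the sense of metric $f(R)$ gravity and with the junction conditions required to hold for all $(t,r)$, to the interior of a collapsing uniform-density dust star.
   Context: Conventions: signature $(+,-,-,-)$, $c=1$, $\kappa=8\pi G>0$, Riemann tensor $R^{\rho}{}_{\sigma\mu\nu}=\partial_\nu\Gamma^\rho_{\sigma\mu}+\Gamma^\rho_{\lambda\nu}\Gamma^\lambda_{\sigma\mu}-(\mu\leftrightarrow\nu)$, $R_{\mu\nu}=R^\lambda{}_{\mu\lambda\nu}$, $R=g^{\mu\nu}R_{\mu\nu}$. $f$ is a smooth real function on an interval, $f_R=f'$. The field equations of metric $f(R)$ gravity are $$f_R(R)R_{\mu\nu}-\tfrac12 f(R)g_{\mu\nu}+(\nabla_\mu\nabla_\nu-g_{\mu\nu}\square)f_R(R)=-\kappa T_{\mu\nu}.$$ Interior (collapsing uniform-density dust star): constants $k\in\mathbb R$, $\rho_0>0$, $\chi_*>0$ with $1-k\chi_*^2>0$, and a smooth scale factor $a(\tau)>0$ on $[0,\tau_c)$ with $a(0)=1$, $\dot a(0)=0$ and $\dot a(\tau)<0$ for $0<\tau<\tau_c$ (collapse). The metric, for $0\le \chi\le\chi_*$, is $$ds_-^2=d\tau^2-a^2(\tau)\left(\frac{d\chi^2}{1-k\chi^2}+\chi^2d\Omega_{(2)}^2\right),$$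 and it satisfies the field equations with $T_{\mu\nu}=\rho u_\mu u_\nu$, $u=\partial_\tau$, $\rho(\tau)=\rho_0/a^3(\tau)$. Its Ricci scalar is $R^-=6\left(\frac{\dot a^2+k}{a^2}+\frac{\ddot a}{a}\right)$. Exterior: a metric $ds_+^2=A(t,r)dt^2-B(t,r)dr^2-r^2d\Omega_{(2)}^2$ with smooth $A,B>0$ on an open domain $\mathcal D$ of the $(t,r)$ half-plane $r>0$, solving the field equations with $T_{\mu\nu}=0$; its Ricci scalar is $R^+$. (In the claim $A=UV$ and $B=V^{-1}$, with smooth $U,V>0$.) Subscripts $t,r$ on $A,B,R^+$ denote partial derivatives. Matching surface: the timelike hypersurface $\Sigma_*$ given by $\chi=\chi_*$ in interior coordinates and by $t=t_*(\tau)$, $r=r_*(\tau)$ (smooth, $\dot t_*>0$, curve contained in $\mathcal D$) in exterior coordinates, with intrinsic coordinates $(\tau,\theta,\varphi)$. Smooth matching: for a quantity $Q$, $[Q]$ is the difference of its values on $\Sigma_*$ computed from the exterior and from the interior. The four junction conditions along $\Sigma_*$ are $[h_{ab}]=0$ (induced metric), $[K_{ab}]=0$ (extrinsic curvature), $[R]=0$, and $[n^\mu\partial_\mu R]=0$, with $n$ the unit normal to $\Sigma_*$. Junction conditions for all $(t,r)$: put $\beta_0=\sqrt{1-k\chi_*^2}$. The first two junction conditions imply $\dot t_*=\beta_0\sqrt{B/A}$ and $\dot r_*^2=\beta_0^2-1/B$ along the surface. Besides the four conditions on $\Sigma_*$, it is required that the resulting relations hold at every point of $\mathcal D$: $\beta_0^2-1/B\ge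 0$ on $\mathcal D$ and, with $u^t=\beta_0\sqrt{B/A}$, $u^r=-\sqrt{\beta_0^2-1/B}$ and $D=u^t\partial_t+u^r\partial_r$, (i) $D\big(\beta_0\sqrt{AB}\big)=\tfrac12\big[A_t (u^t)^2-B_t (u^r)^2\big]$; (ii) $R^+=6\left(\frac{(u^r)^2+1-\beta_0^2}{r^2}+\frac{D(u^r)}{r}\right)$ wherever $u^r\ne0$; (iii) $\frac{u^r}{A}R^+_t+\frac{u^t}{B}R^+_r=0$. *)

theory Defs
  imports "HOL-Analysis.Analysis"
begin

section \<open>Smooth functions\<close>

text \<open>On an open set of a finite-dimensional space this is the class of \<open>k\<close> times continuously
  differentiable functions.\<close>

primrec Ck_on :: "nat \<Rightarrow> 'a::real_normed_vector set \<Rightarrow> ('a \<Rightarrow> 'b::real_normed_vector) \<Rightarrow> bool" where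
  "Ck_on 0 S f \<longleftrightarrow> continuous_on S f"
| "Ck_on (Suc k) S f \<longleftrightarrow>
     (\<forall>x\<in>S. f differentiable (at x)) \<and> (\<forall>v. Ck_on k S (\<lambda>x. frechet_derivative f (at x) v))"

text \<open>On a set that need not be open, such as a half-open interval, smooth means: smooth on some
  open neighbourhood. A function given on \<open>[0, c)\<close> is thus represented by any smooth extension of
  it beyond \<open>0\<close>; the two-sided derivatives of the extension at \<open>0\<close> are the one-sided derivatives
  of the given function.\<close>

definition smooth_on :: "'a::real_normed_vector set \<Rightarrow> ('a \<Rightarrow> 'b::real_normed_vector) \<Rightarrow> bool" where
  "smooth_on S f \<longleftrightarrow> (\<exists>T. open T \<and> S \<subseteq> T \<and> (\<forall>k. Ck_on k T f))"


section \<open>Tensor calculus in a coordinate chart\<close>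

text \<open>A metric in a chart is the matrix-valued function \<open>x \<mapsto> (g\<^sub>\<mu>\<^sub>\<nu>(x))\<close>. Coordinates are numbered
  \<open>1, 2, 3, 4\<close>, the time coordinate being number \<open>1\<close>.\<close>

type_synonym metric = "real^4 \<Rightarrow> real^4^4"

definition pd :: "'n::finite \<Rightarrow> (real^'n \<Rightarrow> real) \<Rightarrow> real^'n \<Rightarrow> real" where
  "pd \<mu> F x = deriv (\<lambda>s. F (x + s *\<^sub>R axis \<mu> 1)) 0"

definition inv_metric :: "metric \<Rightarrow> metric" where
  "inv_metric g x = matrix_inv (g x)"

definition christoffel :: "metric \<Rightarrow> 4 \<Rightarrow> 4 \<Rightarrow> 4 \<Rightarrow> real^4 \<Rightarrow> real" where
  "christoffel g \<alpha> \<mu> \<nu> x = 1/2 * (\<Sum>\<sigma>\<in>UNIV. inv_metric g x $ \<alpha> $ \<sigma> *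
     (pd \<mu> (\<lambda>y. g y $ \<sigma> $ \<nu>) x + pd \<nu> (\<lambda>y. g y $ \<sigma> $ \<mu>) x - pd \<sigma> (\<lambda>y. g y $ \<mu> $ \<nu>) x))"

text \<open>Sign convention: \<open>R\<^sup>\<rho>\<^sub>\<sigma>\<^sub>\<mu>\<^sub>\<nu> = \<partial>\<^sub>\<nu>\<Gamma>\<^sup>\<rho>\<^sub>\<sigma>\<^sub>\<mu> + \<Gamma>\<^sup>\<rho>\<^sub>\<lambda>\<^sub>\<nu>\<Gamma>\<^sup>\<lambda>\<^sub>\<sigma>\<^sub>\<mu> - (\<mu> \<leftrightarrow> \<nu>)\<close>.\<close>

definition riemann :: "metric \<Rightarrow> 4 \<Rightarrow> 4 \<Rightarrow> 4 \<Rightarrow> 4 \<Rightarrow> real^4 \<Rightarrow> real" where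
  "riemann g \<rho> \<sigma> \<mu> \<nu> x =
     (pd \<nu> (christoffel g \<rho> \<sigma> \<mu>) x
        + (\<Sum>\<alpha>\<in>UNIV. christoffel g \<rho> \<alpha> \<nu> x * christoffel g \<alpha> \<sigma> \<mu> x))
   - (pd \<mu> (christoffel g \<rho> \<sigma> \<nu>) x
        + (\<Sum>\<alpha>\<in>UNIV. christoffel g \<rho> \<alpha> \<mu> x * christoffel g \<alpha> \<sigma> \<nu> x))"

definition ricci :: "metric \<Rightarrow> 4 \<Rightarrow> 4 \<Rightarrow> real^4 \<Rightarrow> real" where
  "ricci g \<mu> \<nu> x = (\<Sum>\<alpha>\<in>UNIV. riemann g \<alpha> \<mu> \<alpha> \<nu> x)"

definition ricci_scalar :: "metric \<Rightarrow> real^4 \<Rightarrow> real" where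
  "ricci_scalar g x = (\<Sum>\<mu>\<in>UNIV. \<Sum>\<nu>\<in>UNIV. inv_metric g x $ \<mu> $ \<nu> * ricci g \<mu> \<nu> x)"

definition hessian :: "metric \<Rightarrow> (real^4 \<Rightarrow> real) \<Rightarrow> 4 \<Rightarrow> 4 \<Rightarrow> real^4 \<Rightarrow> real" where
  "hessian g F \<mu> \<nu> x = pd \<mu> (pd \<nu> F) x - (\<Sum>\<alpha>\<in>UNIV. christoffel g \<alpha> \<mu> \<nu> x * pd \<alpha> F x)"

definition box :: "metric \<Rightarrow> (real^4 \<Rightarrow> real) \<Rightarrow> real^4 \<Rightarrow> real" where
  "box g F x = (\<Sum>\<mu>\<in>UNIV. \<Sum>\<nu>\<in>UNIV. inv_metric g x $ \<mu> $ \<nu> * hessian g F \<mu> \<nu> x)"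

definition inner_g :: "metric \<Rightarrow> real^4 \<Rightarrow> real^4 \<Rightarrow> real^4 \<Rightarrow> real" where
  "inner_g g x v w = (\<Sum>\<mu>\<in>UNIV. \<Sum>\<nu>\<in>UNIV. g x $ \<mu> $ \<nu> * v $ \<mu> * w $ \<nu>)"

definition lower :: "metric \<Rightarrow> real^4 \<Rightarrow> real^4 \<Rightarrow> real^4" where
  "lower g x v = g x *v v"


section \<open>Metric f(R) gravity\<close>

definition fR_model :: "(real \<Rightarrow> real) \<Rightarrow> real set \<Rightarrow> bool" where
  "fR_model f I \<longleftrightarrow> is_interval I \<and> interior I \<noteq> {} \<and> smooth_on I f"

definition fR_field_equations ::
    "(real \<Rightarrow> real) \<Rightarrow> real set \<Rightarrow> real \<Rightarrow> metric \<Rightarrow> (4 \<Rightarrow> 4 \<Rightarrow> real^4 \<Rightarrow> real) \<Rightarrow> (real^4) set \<Rightarrow> bool" where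
  "fR_field_equations f I \<kappa> g T S \<longleftrightarrow> (\<forall>x\<in>S. ricci_scalar g x \<in> I \<and>
     (let f\<^sub>R = (\<lambda>y. deriv f (ricci_scalar g y)) in
      \<forall>\<mu> \<nu>. f\<^sub>R x * ricci g \<mu> \<nu> x - 1/2 * f (ricci_scalar g x) * g x $ \<mu> $ \<nu>
              + (hessian g f\<^sub>R \<mu> \<nu> x - g x $ \<mu> $ \<nu> * box g f\<^sub>R x)
            = - \<kappa> * T \<mu> \<nu> x))"


section \<open>Interior and exterior\<close>

definition diag4 :: "real \<Rightarrow> real \<Rightarrow> real \<Rightarrow> real \<Rightarrow> real^4^4" where
  "diag4 p q r s = (\<chi> i j. if i = j then (vector [p, q, r, s] :: real^4) $ i else 0)"

text \<open>Interior coordinates \<open>(\<tau>, \<chi>, \<theta>, \<phi>)\<close>, exterior coordinates \<open>(t, r, \<theta>, \<phi>)\<close>.\<close>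

definition int_metric :: "real \<Rightarrow> (real \<Rightarrow> real) \<Rightarrow> metric" where
  "int_metric k a x =
     diag4 1 (- ((a (x$1))\<^sup>2 / (1 - k * (x$2)\<^sup>2)))
             (- ((a (x$1))\<^sup>2 * (x$2)\<^sup>2)) (- ((a (x$1))\<^sup>2 * (x$2)\<^sup>2 * (sin (x$3))\<^sup>2))"

definition ext_metric :: "(real \<Rightarrow> real \<Rightarrow> real) \<Rightarrow> (real \<Rightarrow> real \<Rightarrow> real) \<Rightarrow> metric" where
  "ext_metric A B x =
     diag4 (A (x$1) (x$2)) (- B (x$1) (x$2)) (- ((x$2)\<^sup>2)) (- ((x$2)\<^sup>2 * (sin (x$3))\<^sup>2))"

definition dust_stress :: "metric \<Rightarrow> (real^4 \<Rightarrow> real) \<Rightarrow> (real^4 \<Rightarrow> real^4) \<Rightarrow> 4 \<Rightarrow> 4 \<Rightarrow> real^4 \<Rightarrow> real" where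
  "dust_stress g \<rho> u \<mu> \<nu> x = \<rho> x * lower g x (u x) $ \<mu> * lower g x (u x) $ \<nu>"

text \<open>The chart excludes the coordinate singularities \<open>\<chi> = 0\<close> and \<open>sin \<theta> = 0\<close>. The metric formula
  makes sense slightly beyond \<open>\<tau> = 0\<close> and \<open>\<chi> = \<chi>\<^sub>*\<close>, so the derivatives there are defined.\<close>

definition collapsing_dust_star ::
    "(real \<Rightarrow> real) \<Rightarrow> real set \<Rightarrow> real \<Rightarrow> real \<Rightarrow> real \<Rightarrow> real \<Rightarrow> real \<Rightarrow> (real \<Rightarrow> real) \<Rightarrow> bool" where
  "collapsing_dust_star f I \<kappa> k \<rho>\<^sub>0 \<chi>\<^sub>s \<tau>\<^sub>c a \<longleftrightarrow>
     \<rho>\<^sub>0 > 0 \<and> \<chi>\<^sub>s > 0 \<and> 1 - k * \<chi>\<^sub>s\<^sup>2 > 0 \<and> \<tau>\<^sub>c > 0 \<and>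
     smooth_on {0..<\<tau>\<^sub>c} a \<and> (\<forall>\<tau>\<in>{0..<\<tau>\<^sub>c}. a \<tau> > 0) \<and>
     a 0 = 1 \<and> deriv a 0 = 0 \<and> (\<forall>\<tau>\<in>{0<..<\<tau>\<^sub>c}. deriv a \<tau> < 0) \<and>
     fR_field_equations f I \<kappa> (int_metric k a)
       (dust_stress (int_metric k a) (\<lambda>x. \<rho>\<^sub>0 / a (x$1) ^ 3) (\<lambda>x. axis 1 1))
       {x. 0 \<le> x$1 \<and> x$1 < \<tau>\<^sub>c \<and> 0 < x$2 \<and> x$2 \<le> \<chi>\<^sub>s \<and> 0 < x$3 \<and> x$3 < pi}"

definition vacuum_exterior ::
    "(real \<Rightarrow> real) \<Rightarrow> real set \<Rightarrow> real \<Rightarrow> (real \<times> real) set \<Rightarrow>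
     (real \<Rightarrow> real \<Rightarrow> real) \<Rightarrow> (real \<Rightarrow> real \<Rightarrow> real) \<Rightarrow> bool" where
  "vacuum_exterior f I \<kappa> \<D> A B \<longleftrightarrow>
     open \<D> \<and> (\<forall>(t, r)\<in>\<D>. r > 0) \<and>
     smooth_on \<D> (\<lambda>(t, r). A t r) \<and> smooth_on \<D> (\<lambda>(t, r). B t r) \<and>
     (\<forall>(t, r)\<in>\<D>. A t r > 0 \<and> B t r > 0) \<and>
     fR_field_equations f I \<kappa> (ext_metric A B) (\<lambda>\<mu> \<nu> x. 0)
       {x. (x$1, x$2) \<in> \<D> \<and> 0 < x$3 \<and> x$3 < pi}"


section \<open>Hypersurfaces and matching\<close>

text \<open>A hypersurface is given by its parametrization \<open>X\<close>, with intrinsic coordinates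
  \<open>(\<tau>, \<theta>, \<phi>)\<close> numbered \<open>1, 2, 3\<close>.\<close>

definition tangent :: "(real^3 \<Rightarrow> real^4) \<Rightarrow> 3 \<Rightarrow> real^3 \<Rightarrow> real^4" where
  "tangent X b y = (\<chi> \<mu>. pd b (\<lambda>z. X z $ \<mu>) y)"

definition induced_metric :: "metric \<Rightarrow> (real^3 \<Rightarrow> real^4) \<Rightarrow> 3 \<Rightarrow> 3 \<Rightarrow> real^3 \<Rightarrow> real" where
  "induced_metric g X b c y = inner_g g (X y) (tangent X b y) (tangent X c y)"

text \<open>The normal is spacelike, so it has norm \<open>-1\<close> in signature \<open>(+,-,-,-)\<close>. Its orientation is
  not prescribed.\<close>

definition unit_normal :: "metric \<Rightarrow> (real^3 \<Rightarrow> real^4) \<Rightarrow> (real^3) set \<Rightarrow> (real^3 \<Rightarrow> real^4) \<Rightarrow> bool" where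
  "unit_normal g X S n \<longleftrightarrow> smooth_on S n \<and>
     (\<forall>y\<in>S. inner_g g (X y) (n y) (n y) = -1 \<and> (\<forall>b. inner_g g (X y) (n y) (tangent X b y) = 0))"

text \<open>\<open>K\<^sub>b\<^sub>c = e\<^sub>b\<^sup>\<mu> e\<^sub>c\<^sup>\<nu> \<nabla>\<^sub>\<mu> n\<^sub>\<nu>\<close>, where \<open>e\<^sub>b\<^sup>\<mu> \<partial>\<^sub>\<mu> n\<^sub>\<nu>\<close> is the derivative of \<open>n\<^sub>\<nu>\<close> along the surface.\<close>

definition extrinsic_curvature ::
    "metric \<Rightarrow> (real^3 \<Rightarrow> real^4) \<Rightarrow> (real^3 \<Rightarrow> real^4) \<Rightarrow> 3 \<Rightarrow> 3 \<Rightarrow> real^3 \<Rightarrow> real" where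
  "extrinsic_curvature g X n b c y =
     (\<Sum>\<nu>\<in>UNIV. tangent X c y $ \<nu> *
        (pd b (\<lambda>z. lower g (X z) (n z) $ \<nu>) y
         - (\<Sum>\<mu>\<in>UNIV. \<Sum>\<alpha>\<in>UNIV.
              christoffel g \<alpha> \<mu> \<nu> (X y) * tangent X b y $ \<mu> * lower g (X y) (n y) $ \<alpha>)))"

definition normal_derivative :: "(real^4 \<Rightarrow> real) \<Rightarrow> (real^3 \<Rightarrow> real^4) \<Rightarrow> (real^3 \<Rightarrow> real^4) \<Rightarrow> real^3 \<Rightarrow> real" where
  "normal_derivative F X n y = (\<Sum>\<mu>\<in>UNIV. n y $ \<mu> * pd \<mu> F (X y))"

definition junction_conditions ::
    "metric \<Rightarrow> (real^3 \<Rightarrow> real^4) \<Rightarrow> (real^3 \<Rightarrow> real^4) \<Rightarrow>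
     metric \<Rightarrow> (real^3 \<Rightarrow> real^4) \<Rightarrow> (real^3 \<Rightarrow> real^4) \<Rightarrow> (real^3) set \<Rightarrow> bool" where
  "junction_conditions g\<^sub>m X\<^sub>m n\<^sub>m g\<^sub>p X\<^sub>p n\<^sub>p S \<longleftrightarrow> (\<forall>y\<in>S.
     (\<forall>b c. induced_metric g\<^sub>p X\<^sub>p b c y = induced_metric g\<^sub>m X\<^sub>m b c y) \<and>
     (\<forall>b c. extrinsic_curvature g\<^sub>p X\<^sub>p n\<^sub>p b c y = extrinsic_curvature g\<^sub>m X\<^sub>m n\<^sub>m b c y) \<and>
     ricci_scalar g\<^sub>p (X\<^sub>p y) = ricci_scalar g\<^sub>m (X\<^sub>m y) \<and>
     normal_derivative (ricci_scalar g\<^sub>p) X\<^sub>p n\<^sub>p y = normal_derivative (ricci_scalar g\<^sub>m) X\<^sub>m n\<^sub>m y)"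

definition int_surface :: "real \<Rightarrow> real^3 \<Rightarrow> real^4" where
  "int_surface \<chi>\<^sub>s y = vector [y$1, \<chi>\<^sub>s, y$2, y$3]"

definition ext_surface :: "(real \<Rightarrow> real) \<Rightarrow> (real \<Rightarrow> real) \<Rightarrow> real^3 \<Rightarrow> real^4" where
  "ext_surface t\<^sub>s r\<^sub>s y = vector [t\<^sub>s (y$1), r\<^sub>s (y$1), y$2, y$3]"

definition smoothly_matched ::
    "real \<Rightarrow> real \<Rightarrow> real \<Rightarrow> (real \<Rightarrow> real) \<Rightarrow> (real \<times> real) set \<Rightarrow>
     (real \<Rightarrow> real \<Rightarrow> real) \<Rightarrow> (real \<Rightarrow> real \<Rightarrow> real) \<Rightarrow> (real \<Rightarrow> real) \<Rightarrow> (real \<Rightarrow> real) \<Rightarrow> bool" where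
  "smoothly_matched k \<chi>\<^sub>s \<tau>\<^sub>c a \<D> A B t\<^sub>s r\<^sub>s \<longleftrightarrow>
     smooth_on {0..<\<tau>\<^sub>c} t\<^sub>s \<and> smooth_on {0..<\<tau>\<^sub>c} r\<^sub>s \<and>
     (\<forall>\<tau>\<in>{0..<\<tau>\<^sub>c}. deriv t\<^sub>s \<tau> > 0 \<and> (t\<^sub>s \<tau>, r\<^sub>s \<tau>) \<in> \<D>) \<and>
     (let S = {y :: real^3. 0 \<le> y$1 \<and> y$1 < \<tau>\<^sub>c \<and> 0 < y$2 \<and> y$2 < pi};
          g\<^sub>m = int_metric k a; X\<^sub>m = int_surface \<chi>\<^sub>s;
          g\<^sub>p = ext_metric A B; X\<^sub>p = ext_surface t\<^sub>s r\<^sub>s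
      in \<exists>n\<^sub>m n\<^sub>p. unit_normal g\<^sub>m X\<^sub>m S n\<^sub>m \<and> unit_normal g\<^sub>p X\<^sub>p S n\<^sub>p \<and>
           junction_conditions g\<^sub>m X\<^sub>m n\<^sub>m g\<^sub>p X\<^sub>p n\<^sub>p S)"


section \<open>Junction conditions at every exterior point\<close>

definition d_t :: "(real \<Rightarrow> real \<Rightarrow> real) \<Rightarrow> real \<Rightarrow> real \<Rightarrow> real" where
  "d_t F t r = deriv (\<lambda>s. F s r) t"

definition d_r :: "(real \<Rightarrow> real \<Rightarrow> real) \<Rightarrow> real \<Rightarrow> real \<Rightarrow> real" where
  "d_r F t r = deriv (\<lambda>s. F t s) r"

text \<open>By spherical symmetry the Ricci scalar does not depend on the angles; it is evaluated at
  \<open>\<theta> = \<pi>/2\<close>, \<open>\<phi> = 0\<close>.\<close>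

definition ext_ricci_scalar :: "(real \<Rightarrow> real \<Rightarrow> real) \<Rightarrow> (real \<Rightarrow> real \<Rightarrow> real) \<Rightarrow> real \<Rightarrow> real \<Rightarrow> real" where
  "ext_ricci_scalar A B t r = ricci_scalar (ext_metric A B) (vector [t, r, pi / 2, 0])"

definition junction_everywhere ::
    "real \<Rightarrow> real \<Rightarrow> (real \<times> real) set \<Rightarrow> (real \<Rightarrow> real \<Rightarrow> real) \<Rightarrow> (real \<Rightarrow> real \<Rightarrow> real) \<Rightarrow> bool" where
  "junction_everywhere k \<chi>\<^sub>s \<D> A B \<longleftrightarrow>
     (let \<beta>\<^sub>0 = sqrt (1 - k * \<chi>\<^sub>s\<^sup>2);
          u\<^sub>t = (\<lambda>t r. \<beta>\<^sub>0 * sqrt (B t r / A t r));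
          u\<^sub>r = (\<lambda>t r. - sqrt (\<beta>\<^sub>0\<^sup>2 - 1 / B t r));
          D = (\<lambda>F t r. u\<^sub>t t r * d_t F t r + u\<^sub>r t r * d_r F t r);
          R = ext_ricci_scalar A B
      in \<forall>(t, r)\<in>\<D>.
           \<beta>\<^sub>0\<^sup>2 - 1 / B t r \<ge> 0 \<and>
           D (\<lambda>t r. \<beta>\<^sub>0 * sqrt (A t r * B t r)) t r
             = 1/2 * (d_t A t r * (u\<^sub>t t r)\<^sup>2 - d_t B t r * (u\<^sub>r t r)\<^sup>2) \<and>
           (u\<^sub>r t r \<noteq> 0 \<longrightarrow>
              R t r = 6 * (((u\<^sub>r t r)\<^sup>2 + 1 - \<beta>\<^sub>0\<^sup>2) / r\<^sup>2 + D u\<^sub>r t r / r)) \<and>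
           u\<^sub>r t r / A t r * d_t R t r + u\<^sub>t t r / B t r * d_r R t r = 0)"

end

theory Submission
  imports Defs
begin

text \<open>The interior fixes \<open>r\<^sub>* = a \<chi>\<^sub>*\<close>, and the \<open>\<theta>\<theta>\<close> component of \<open>[K\<^sub>a\<^sub>b] = 0\<close> gives
  \<open>\<beta>\<^sub>0\<^sup>2 - V(r\<^sub>*) = (dr\<^sub>*/d\<tau>)\<^sup>2\<close>, which is positive during the collapse, so \<open>u\<^sup>r \<noteq> 0\<close> around the
  surface. There condition (ii) reads \<open>R\<^sup>+ = G(r) = 6 ((1 - V)/r\<^sup>2 - V'/(2r))\<close>, and as \<open>R\<^sup>+\<close> does not
  depend on \<open>t\<close>, condition (iii) forces \<open>G' = 0\<close>. Hence \<open>R\<^sup>+\<close> is constant along the surface, and by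
  \<open>[R] = 0\<close> and homogeneity \<open>R\<^sup>-\<close> is constant throughout the interior. Then \<open>f\<^sub>R\<close> is constant there as well,
  and the trace \<open>f\<^sub>R R - 2 f = -\<kappa> \<rho>\<^sub>0 / a\<^sup>3\<close> of the field equations contradicts \<open>a\<close> being strictly
  decreasing.\<close>

section \<open>Coordinate derivatives and diagonal metrics\<close>

lemma pd_eqI:
  assumes "((\<lambda>s. F (x + s *\<^sub>R axis \<mu> 1)) has_field_derivative D) (at 0)"
  shows "pd \<mu> F x = D"
  using assms unfolding pd_def by (rule DERIV_imp_deriv)

text \<open>Closed forms for the Christoffel symbols will hold only on an open chart. Since
  \<open>pd\<close> depends only on values near \<open>x\<close>, they may still be
  differentiated.\<close>

lemma pd_cong_open:
  fixes x :: "real^'n"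
  assumes "open S" "x \<in> S" "\<And>y. y \<in> S \<Longrightarrow> F y = G y"
  shows "pd \<mu> F x = pd \<mu> G x"
proof -
  have "((\<lambda>s. x + s *\<^sub>R axis \<mu> 1) \<longlongrightarrow> x + 0 *\<^sub>R axis \<mu> 1) (nhds (0::real))"
    by (intro tendsto_intros filterlim_ident)
  then have "\<forall>\<^sub>F s in nhds (0::real). x + s *\<^sub>R axis \<mu> 1 \<in> S"
    using assms(1,2) by (auto dest: topological_tendstoD)
  then have "\<forall>\<^sub>F s in nhds (0::real). F (x + s *\<^sub>R axis \<mu> 1) = G (x + s *\<^sub>R axis \<mu> 1)"
    by eventually_elim (rule assms(3))
  then show ?thesis
    unfolding pd_def by (rule deriv_cong_ev) simp
qed

lemma pd_const [simp]: "pd \<mu> (\<lambda>y. c) x = 0"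
  unfolding pd_def by simp


lemma vector_4 [simp]:
  "(vector [w,x,y,z] :: ('a::zero)^4) $ 1 = w"
  "(vector [w,x,y,z] :: ('a::zero)^4) $ 2 = x"
  "(vector [w,x,y,z] :: ('a::zero)^4) $ 3 = y"
  "(vector [w,x,y,z] :: ('a::zero)^4) $ 4 = z"
  unfolding vector_def by simp_all

text \<open>\<open>matrix_inv\<close> is a choice: the reciprocal diagonal matrix shows that a
  two-sided inverse exists, and multiplying by it from the left identifies the chosen one.\<close>

lemma inv_metric_diagonal:
  assumes "\<And>i j. g x $ i $ j = (if i = j then d i else 0)" "\<And>i. d i \<noteq> 0"
  shows "inv_metric g x $ i $ j = (if i = j then 1 / d i else 0)"
proof -
  let ?h = "(\<chi> i j. if i = j then 1 / d i else 0) :: real^4^4"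
  have g: "g x = (\<chi> i j. if i = j then d i else 0)"
    using assms(1) by (simp add: vec_eq_iff)
  have h: "g x ** ?h = mat 1" "?h ** g x = mat 1"
    unfolding g matrix_matrix_mult_def mat_def
    using assms(2) by (simp_all add: vec_eq_iff if_distrib[of "\<lambda>u. u * _"] cong: if_cong)
  have "g x ** matrix_inv (g x) = mat 1"
    unfolding matrix_inv_def using someI[of "\<lambda>h. g x ** h = mat 1 \<and> h ** g x = mat 1", OF conjI[OF h]]
    by blast
  then have "?h ** (g x ** matrix_inv (g x)) = ?h"
    by (simp only: matrix_mul_rid)
  then have "matrix_inv (g x) = ?h"
    by (simp only: matrix_mul_assoc h(2) matrix_mul_lid)
  then show ?thesis
    by (simp add: inv_metric_def)
qed

text \<open>A diagonal inverse keeps only the summand \<sigma> = \<alpha>. Diagonality is assumed at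
  every point because the entries get differentiated; nonvanishing is a condition at
  \<open>x\<close> alone.\<close>

lemma christoffel_diagonal:
  assumes g: "\<And>y i j. g y $ i $ j = (if i = j then d i y else 0)" and d: "\<And>i. d i x \<noteq> 0"
  shows "christoffel g \<alpha> \<mu> \<nu> x =
    ((if \<alpha> = \<nu> then pd \<mu> (d \<alpha>) x else 0) + (if \<alpha> = \<mu> then pd \<nu> (d \<alpha>) x else 0)
      - (if \<mu> = \<nu> then pd \<alpha> (d \<mu>) x else 0)) / (2 * d \<alpha> x)"
proof -
  have [simp]: "pd i (\<lambda>y. if \<alpha> = \<beta> then d \<alpha> y else 0) x = (if \<alpha> = \<beta> then pd i (d \<alpha>) x else 0)"
    for i \<alpha> \<beta> by (cases "\<alpha> = \<beta>") auto
  have i: "inv_metric g x $ i $ j = (if i = j then 1 / d i x else 0)" for i j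
    by (rule inv_metric_diagonal) (simp_all add: g d)
  show ?thesis
    unfolding christoffel_def i g
    by (simp add: if_distrib[of "\<lambda>u. u * _"] cong: if_cong)
qed

lemma christoffel_diagonal_same:
  assumes g: "\<And>y i j. g y $ i $ j = (if i = j then d i y else 0)" and d: "\<And>i. d i x \<noteq> 0"
    and "\<mu> \<noteq> \<alpha>"
  shows "christoffel g \<alpha> \<mu> \<mu> x = - pd \<alpha> (d \<mu>) x / (2 * d \<alpha> x)"
  using christoffel_diagonal[where d=d, OF g d] assms(3) by simp

lemma diag4_nth:
  "diag4 p q r s $ i $ j = (if i = j then (vector [p, q, r, s] :: real^4) $ i else 0)"
  by (simp add: diag4_def)

text \<open>A named constant, so that simplification treats the denominator \<open>1 - k \<chi>\<^sup>2\<close> as one nonzero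
  atom instead of multiplying it out.\<close>

definition curv :: "real \<Rightarrow> real \<Rightarrow> real" where
  "curv k y = 1 - k * y\<^sup>2"

lemma curv_deriv [derivative_intros]:
  assumes "(h has_field_derivative e) (at s)"
  shows "((\<lambda>s. curv k (h s)) has_field_derivative - 2 * k * h s * e) (at s)"
  unfolding curv_def by (rule derivative_eq_intros assms refl)+ simp

definition int_diag :: "real \<Rightarrow> (real \<Rightarrow> real) \<Rightarrow> 4 \<Rightarrow> real^4 \<Rightarrow> real" where
  "int_diag k a i y = (vector [1, - ((a (y$1))\<^sup>2 / curv k (y$2)), - ((a (y$1))\<^sup>2 * (y$2)\<^sup>2),
      - ((a (y$1))\<^sup>2 * (y$2)\<^sup>2 * (sin (y$3))\<^sup>2)] :: real^4) $ i"

lemma int_metric_nth: "int_metric k a y $ i $ j = (if i = j then int_diag k a i y else 0)"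
  by (simp add: int_metric_def diag4_nth int_diag_def curv_def)

lemma int_diag_simps:
  "int_diag k a 1 = (\<lambda>y. 1)"
  "int_diag k a 2 = (\<lambda>y. - ((a (y$1))\<^sup>2 / curv k (y$2)))"
  "int_diag k a 3 = (\<lambda>y. - ((a (y$1))\<^sup>2 * (y$2)\<^sup>2))"
  "int_diag k a 4 = (\<lambda>y. - ((a (y$1))\<^sup>2 * (y$2)\<^sup>2 * (sin (y$3))\<^sup>2))"
  by (simp_all add: int_diag_def fun_eq_iff)

text \<open>Every point of \<open>S\<close>, even an endpoint, lies in the open set \<open>T\<close>
  from \<open>smooth_on\<close>, so two-sided derivatives exist. On \<open>T\<close> the Frechet
  derivative in direction 1 is \<open>deriv f\<close>, which turns the second order of
  \<open>Ck_on\<close> into differentiability of \<open>deriv f\<close>.\<close>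

lemma smooth_on_deriv:
  fixes f :: "real \<Rightarrow> real"
  assumes "smooth_on S f" "x \<in> S"
  shows "(f has_field_derivative deriv f x) (at x)"
    and "(deriv f has_field_derivative deriv (deriv f) x) (at x)"
proof -
  obtain T where T: "open T" "x \<in> T" and f: "Ck_on (Suc (Suc 0)) T f"
    using assms unfolding smooth_on_def by blast
  have d: "(f has_field_derivative deriv f y) (at y)" if "y \<in> T" for y
    using f that by (simp add: DERIV_deriv_iff_real_differentiable)
  then show "(f has_field_derivative deriv f x) (at x)"
    using T by blast
  have eq: "frechet_derivative f (at y) 1 = deriv f y" if "y \<in> T" for y
    using frechet_derivative_at[OF d[OF that, unfolded has_field_derivative_def], symmetric] by simp
  have "(\<lambda>y. frechet_derivative f (at y) 1) differentiable (at x)"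
    using f T by simp
  then have "((\<lambda>y. frechet_derivative f (at y) 1) has_field_derivative
      deriv (\<lambda>y. frechet_derivative f (at y) 1) x) (at x)"
    by (simp add: DERIV_deriv_iff_real_differentiable)
  then have "(deriv f has_field_derivative deriv (\<lambda>y. frechet_derivative f (at y) 1) x) (at x)"
    using T eq by (rule has_field_derivative_transform_within_open) auto
  then show "(deriv f has_field_derivative deriv (deriv f) x) (at x)"
    using DERIV_imp_deriv by fastforce
qed

text \<open>No differentiability of \<open>h\<close> is assumed: \<open>deriv\<close> is chosen
  among the derivative values at a point, and a translation does not change which values these
  are.\<close>

lemma pd_comp_nth:
  "pd i (\<lambda>z. h (z $ j)) y = (if i = j then deriv h (y $ j) else 0)"
proof -
  have "deriv (\<lambda>s. h (x + s)) 0 = deriv h x" for x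
    unfolding deriv_def using DERIV_shift[of h _ 0 x] by (simp add: add.commute)
  then show ?thesis
    by (simp add: pd_def axis_def)
qed

lemma pd_nth: "pd i (\<lambda>z. z $ j) y = (if i = j then 1 else 0)"
  using pd_comp_nth[of i "\<lambda>u. u" j y] by simp

section \<open>Tangents, normals and extrinsic curvature of a hypersurface\<close>

lemma lower_diagonal:
  assumes "\<And>y i j. g y $ i $ j = (if i = j then d i y else 0)"
  shows "lower g x v $ i = d i x * v $ i"
  by (simp add: lower_def matrix_vector_mult_def assms if_distrib[of "\<lambda>u. u * _"] cong: if_cong)

lemma inner_g_diagonal:
  assumes "\<And>y i j. g y $ i $ j = (if i = j then d i y else 0)"
  shows "inner_g g x v w = (\<Sum>i\<in>UNIV. d i x * v $ i * w $ i)"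
  by (simp add: inner_g_def assms if_distrib[of "\<lambda>u. u * _"] cong: if_cong)

lemma tangent_int_surface:
  "tangent (int_surface \<chi>\<^sub>s) b y = (vector [if b = 1 then 1 else 0, 0,
      if b = 2 then 1 else 0, if b = 3 then 1 else 0] :: real^4)"
  by (simp add: tangent_def int_surface_def vec_eq_iff forall_4 pd_nth)

lemma tangent_ext_surface:
  "tangent (ext_surface t\<^sub>s r\<^sub>s) b y =
    (vector [if b = 1 then deriv t\<^sub>s (y$1) else 0, if b = 1 then deriv r\<^sub>s (y$1) else 0,
      if b = 2 then 1 else 0, if b = 3 then 1 else 0] :: real^4)"
  by (simp add: tangent_def ext_surface_def vec_eq_iff forall_4 pd_nth pd_comp_nth)

text \<open>The \<open>\<theta>\<theta>\<close> component involves no derivative of the normal: \<open>n\<^sub>\<theta> = 0\<close> along the surface.\<close>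

lemma extrinsic_curvature_polar:
  assumes g: "\<And>y i j. g y $ i $ j = (if i = j then d i y else 0)" and d: "\<And>i. d i (X y) \<noteq> 0"
    and n: "unit_normal g X S n" and S: "open S0" "S0 \<subseteq> S" "y \<in> S0"
    and X: "\<And>z i. tangent X 2 z $ i = (if i = 3 then 1 else 0)"
  shows "extrinsic_curvature g X n 2 2 y = 1/2 * (pd 1 (d 3) (X y) * n y $ 1
      + pd 2 (d 3) (X y) * n y $ 2 + pd 4 (d 3) (X y) * n y $ 4)"
proof -
  \<comment> \<open>The tangent in the polar direction is the third coordinate vector, so
    orthogonality is exactly this equation. It holds on the open set \<open>S0\<close>, hence the
    derivative of this component vanishes too.\<close>
  have n3: "lower g (X z) (n z) $ 3 = 0" if "z \<in> S0" for z
  proof -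
    have "inner_g g (X z) (n z) (tangent X 2 z) = 0"
      using n S(2) that by (auto simp: unit_normal_def)
    then show ?thesis
      by (simp add: inner_g_diagonal[of g d, OF g] lower_diagonal[of g d, OF g] X sum_4)
  qed
  have pd0: "pd 2 (\<lambda>z. lower g (X z) (n z) $ 3) y = 0"
    using pd_cong_open[OF S(1,3) n3, where \<mu>=2] by simp
  \<comment> \<open>Lowering the normal multiplies by \<open>d \<alpha>\<close>, which cancels the
    denominator of the Christoffel symbol.\<close>
  have chr: "christoffel g \<alpha> 3 3 (X y) * lower g (X y) (n y) $ \<alpha>
      = (if \<alpha> = 3 then 0 else - 1/2 * pd \<alpha> (d 3) (X y) * n y $ \<alpha>)" for \<alpha>
  proof (cases "\<alpha> = 3")
    case False
    then show ?thesis
      using christoffel_diagonal_same[of g d, OF g d, of 3 \<alpha>] d[of \<alpha>]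
      by (simp add: lower_diagonal[of g d, OF g])
  qed (simp add: n3[OF S(3)])
  have "extrinsic_curvature g X n 2 2 y
      = - (\<Sum>\<alpha>\<in>UNIV. christoffel g \<alpha> 3 3 (X y) * lower g (X y) (n y) $ \<alpha>)"
    by (simp add: extrinsic_curvature_def X pd0 sum_4)
  then show ?thesis
    unfolding chr by (simp add: sum_4)
qed

definition ext_diag ::
    "(real \<Rightarrow> real \<Rightarrow> real) \<Rightarrow> (real \<Rightarrow> real \<Rightarrow> real) \<Rightarrow> 4 \<Rightarrow> real^4 \<Rightarrow> real" where
  "ext_diag A B i x = (vector [A (x$1) (x$2), - B (x$1) (x$2), - ((x$2)\<^sup>2),
      - ((x$2)\<^sup>2 * (sin (x$3))\<^sup>2)] :: real^4) $ i"

lemma ext_metric_nth: "ext_metric A B y $ i $ j = (if i = j then ext_diag A B i y else 0)"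
  by (simp add: ext_metric_def diag4_nth ext_diag_def)

lemma ext_diag_simps:
  "ext_diag A B 1 = (\<lambda>x. A (x$1) (x$2))"
  "ext_diag A B 2 = (\<lambda>x. - B (x$1) (x$2))"
  "ext_diag A B 3 = (\<lambda>x. - ((x$2)\<^sup>2))"
  "ext_diag A B 4 = (\<lambda>x. - ((x$2)\<^sup>2 * (sin (x$3))\<^sup>2))"
  by (simp_all add: ext_diag_def fun_eq_iff)

section \<open>Curvature and field equations of the interior\<close>

locale frw =
  fixes k c :: real and a a1 a2 :: "real \<Rightarrow> real"
  assumes a_pos: "\<And>\<tau>. 0 < \<tau> \<Longrightarrow> \<tau> < c \<Longrightarrow> a \<tau> > 0"
    and a_deriv: "\<And>\<tau>. 0 < \<tau> \<Longrightarrow> \<tau> < c \<Longrightarrow> (a has_field_derivative a1 \<tau>) (at \<tau>)"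
    and a1_deriv: "\<And>\<tau>. 0 < \<tau> \<Longrightarrow> \<tau> < c \<Longrightarrow> (a1 has_field_derivative a2 \<tau>) (at \<tau>)"
begin

text \<open>The chart is not cut off at the surface of the star: the interior formula is continued
  beyond it, so that surface points with 0 < \<tau> lie inside an open set.\<close>

definition chart :: "(real^4) set" where
  "chart = {x. 0 < x$1 \<and> x$1 < c \<and> 0 < x$2 \<and> 0 < 1 - k * (x$2)\<^sup>2 \<and> 0 < x$3 \<and> x$3 < pi}"

lemma open_chart: "open chart"
  unfolding chart_def
  by (intro open_Collect_conj open_Collect_less continuous_intros)

lemma chartD:
  assumes "x \<in> chart"
  shows "0 < x$1" "x$1 < c" "0 < x$2" "curv k (x$2) > 0" "sin (x$3) > 0" "a (x$1) > 0"
  using assms a_pos by (auto simp: chart_def sin_gt_zero curv_def)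

lemma chart_nonzero:
  assumes "x \<in> chart"
  shows "x$2 \<noteq> 0" "curv k (x$2) \<noteq> 0" "sin (x$3) \<noteq> 0" "a (x$1) \<noteq> 0"
  using chartD[OF assms] by simp_all

lemma int_diag_nonzero:
  assumes "x \<in> chart" shows "int_diag k a i x \<noteq> 0"
  using chart_nonzero[OF assms] exhaust_4[of i] by (auto simp: int_diag_simps)

text \<open>Chain rule along a coordinate line through \<open>x\<close>. The value
  \<open>h s = x$1\<close> is a separate premise because it holds only after simplification at
  \<open>s = 0\<close>.\<close>

lemma a_comp:
  assumes "x \<in> chart" "(h has_field_derivative e) (at s)" "h s = x$1"
  shows "((\<lambda>s. a (h s)) has_field_derivative a1 (x$1) * e) (at s)"
    and "((\<lambda>s. a1 (h s)) has_field_derivative a2 (x$1) * e) (at s)"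
  using DERIV_chain2[OF _ assms(2), of a] DERIV_chain2[OF _ assms(2), of a1]
    a_deriv[of "x$1"] a1_deriv[of "x$1"] assms(3) chartD[OF assms(1)] by auto


lemma pd_int_diag_1: "pd \<mu> (int_diag k a 1) x = 0"
  unfolding int_diag_simps by simp

lemma pd_int_diag_2:
  assumes x: "x \<in> chart"
  shows "pd \<mu> (int_diag k a 2) x =
      (if \<mu> = 1 then - 2 * a (x$1) * a1 (x$1) / curv k (x$2)
       else if \<mu> = 2 then - 2 * k * x$2 * (a (x$1))\<^sup>2 / (curv k (x$2))\<^sup>2 else 0)"
  unfolding int_diag_simps
  using exhaust_4[of \<mu>] chart_nonzero[OF x]
  by (elim disjE; intro pd_eqI)
    (auto simp: axis_def power2_eq_square field_simps intro!: derivative_eq_intros a_comp[OF x])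

lemma pd_int_diag_3:
  assumes x: "x \<in> chart"
  shows "pd \<mu> (int_diag k a 3) x =
      (if \<mu> = 1 then - 2 * a (x$1) * a1 (x$1) * (x$2)\<^sup>2
       else if \<mu> = 2 then - 2 * x$2 * (a (x$1))\<^sup>2 else 0)"
  unfolding int_diag_simps
  using exhaust_4[of \<mu>] chart_nonzero[OF x]
  by (elim disjE; intro pd_eqI)
    (auto simp: axis_def power2_eq_square field_simps intro!: derivative_eq_intros a_comp[OF x])

lemma pd_int_diag_4:
  assumes x: "x \<in> chart"
  shows "pd \<mu> (int_diag k a 4) x =
      (if \<mu> = 1 then - 2 * a (x$1) * a1 (x$1) * (x$2)\<^sup>2 * (sin (x$3))\<^sup>2
       else if \<mu> = 2 then - 2 * x$2 * (a (x$1))\<^sup>2 * (sin (x$3))\<^sup>2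
       else if \<mu> = 3 then - 2 * (a (x$1))\<^sup>2 * (x$2)\<^sup>2 * sin (x$3) * cos (x$3) else 0)"
  unfolding int_diag_simps
  using exhaust_4[of \<mu>] chart_nonzero[OF x]
  by (elim disjE; intro pd_eqI)
    (auto simp: axis_def power2_eq_square field_simps intro!: derivative_eq_intros a_comp[OF x])

text \<open>The connection coefficients of the Friedmann metric. The equation is between functions
  of position, so that it also unfolds under \<open>pd\<close>. The order of the branches matters:
  the one giving \<open>1 / x$2\<close> is reached only for angular \<alpha>.\<close>

definition int_chr :: "4 \<Rightarrow> 4 \<Rightarrow> 4 \<Rightarrow> real^4 \<Rightarrow> real" where
  "int_chr \<alpha> \<mu> \<nu> = (\<lambda>x.
     if \<alpha> = 1 then
       (if \<mu> \<noteq> \<nu> \<or> \<mu> = 1 then 0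
        else if \<mu> = 2 then a (x$1) * a1 (x$1) / curv k (x$2)
        else if \<mu> = 3 then a (x$1) * a1 (x$1) * (x$2)\<^sup>2
        else a (x$1) * a1 (x$1) * (x$2)\<^sup>2 * (sin (x$3))\<^sup>2)
     else if \<mu> = 1 \<and> \<nu> = \<alpha> \<or> \<nu> = 1 \<and> \<mu> = \<alpha> then a1 (x$1) / a (x$1)
     else if \<alpha> = 2 then
       (if \<mu> \<noteq> \<nu> \<or> \<mu> = 1 then 0
        else if \<mu> = 2 then k * x$2 / curv k (x$2)
        else if \<mu> = 3 then - (x$2 * curv k (x$2))
        else - (x$2 * curv k (x$2) * (sin (x$3))\<^sup>2))
     else if \<mu> = 2 \<and> \<nu> = \<alpha> \<or> \<nu> = 2 \<and> \<mu> = \<alpha> then 1 / x$2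
     else if \<alpha> = 3 then (if \<mu> = 4 \<and> \<nu> = 4 then - (sin (x$3) * cos (x$3)) else 0)
     else if \<mu> = 3 \<and> \<nu> = 4 \<or> \<mu> = 4 \<and> \<nu> = 3 then cos (x$3) / sin (x$3)
     else 0)"

lemma christoffel_int_metric:
  assumes x: "x \<in> chart"
  shows "christoffel (int_metric k a) \<alpha> \<mu> \<nu> x = int_chr \<alpha> \<mu> \<nu> x"
proof -
  note pd = pd_int_diag_1 pd_int_diag_2[OF x] pd_int_diag_3[OF x] pd_int_diag_4[OF x]
  have "\<forall>\<alpha> \<mu> \<nu>. christoffel (int_metric k a) \<alpha> \<mu> \<nu> x = int_chr \<alpha> \<mu> \<nu> x"
    unfolding christoffel_diagonal[where d="int_diag k a", OF int_metric_nth int_diag_nonzero[OF x]]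
      int_chr_def forall_4
    using chart_nonzero[OF x]
    by (simp add: pd) (simp add: int_diag_simps field_simps power2_eq_square)
  then show ?thesis by blast
qed

lemma pd_christoffel_int_metric:
  assumes "x \<in> chart"
  shows "pd \<beta> (christoffel (int_metric k a) \<alpha> \<mu> \<nu>) x = pd \<beta> (int_chr \<alpha> \<mu> \<nu>) x"
  by (rule pd_cong_open[OF open_chart assms christoffel_int_metric])

text \<open>These are the nonzero derivatives that occur in the diagonal Ricci components.\<close>

lemma pd_int_chr:
  assumes x: "x \<in> chart"
  shows "pd 1 (\<lambda>y. a1 (y$1) / a (y$1)) x = a2 (x$1) / a (x$1) - (a1 (x$1) / a (x$1))\<^sup>2"
    and "pd 1 (\<lambda>y. a (y$1) * a1 (y$1) / curv k (y$2)) x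
      = ((a1 (x$1))\<^sup>2 + a (x$1) * a2 (x$1)) / curv k (x$2)"
    and "pd 1 (\<lambda>y. a (y$1) * a1 (y$1) * (y$2)\<^sup>2) x = ((a1 (x$1))\<^sup>2 + a (x$1) * a2 (x$1)) * (x$2)\<^sup>2"
    and "pd 1 (\<lambda>y. a (y$1) * a1 (y$1) * (y$2)\<^sup>2 * (sin (y$3))\<^sup>2) x
      = ((a1 (x$1))\<^sup>2 + a (x$1) * a2 (x$1)) * (x$2)\<^sup>2 * (sin (x$3))\<^sup>2"
    and "pd 2 (\<lambda>y. k * y$2 / curv k (y$2)) x
      = (k * curv k (x$2) + 2 * k\<^sup>2 * (x$2)\<^sup>2) / (curv k (x$2))\<^sup>2"
    and "pd 2 (\<lambda>y. - (y$2 * curv k (y$2))) x = 2 * k * (x$2)\<^sup>2 - curv k (x$2)"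
    and "pd 2 (\<lambda>y. - (y$2 * curv k (y$2) * (sin (y$3))\<^sup>2)) x
      = (2 * k * (x$2)\<^sup>2 - curv k (x$2)) * (sin (x$3))\<^sup>2"
    and "pd 2 (\<lambda>y. 1 / y$2) x = - 1 / (x$2)\<^sup>2"
    and "pd 3 (\<lambda>y. - (sin (y$3) * cos (y$3))) x = (sin (x$3))\<^sup>2 - (cos (x$3))\<^sup>2"
    and "pd 3 (\<lambda>y. cos (y$3) / sin (y$3)) x = - 1 - (cos (x$3) / sin (x$3))\<^sup>2"
  by (rule pd_eqI, (auto simp: axis_def power2_eq_square field_simps chart_nonzero[OF x]
       intro!: derivative_eq_intros a_comp[OF x])[1])+


text \<open>The inverse metric is diagonal, so the Ricci scalar and the trace of the field equations
  involve these components only.\<close>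

lemma ricci_int_metric:
  assumes x: "x \<in> chart"
  shows "ricci (int_metric k a) 1 1 x = 3 * a2 (x$1) / a (x$1)"
    and "ricci (int_metric k a) 2 2 x =
      - (a (x$1) * a2 (x$1) + 2 * (a1 (x$1))\<^sup>2 + 2 * k) / curv k (x$2)"
    and "ricci (int_metric k a) 3 3 x =
      - (a (x$1) * a2 (x$1) + 2 * (a1 (x$1))\<^sup>2 + 2 * k) * (x$2)\<^sup>2"
    and "ricci (int_metric k a) 4 4 x =
      - (a (x$1) * a2 (x$1) + 2 * (a1 (x$1))\<^sup>2 + 2 * k) * (x$2)\<^sup>2 * (sin (x$3))\<^sup>2"
proof -
  note nz = chart_nonzero[OF x]
  note unf = ricci_def riemann_def pd_christoffel_int_metric[OF x] christoffel_int_metric[OF x] sum_4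
  show "ricci (int_metric k a) 1 1 x = 3 * a2 (x$1) / a (x$1)"
    unfolding unf
    by (simp add: int_chr_def pd_int_chr[OF x] nz) (simp add: field_simps power2_eq_square nz)
  show "ricci (int_metric k a) 2 2 x =
      - (a (x$1) * a2 (x$1) + 2 * (a1 (x$1))\<^sup>2 + 2 * k) / curv k (x$2)"
    unfolding unf
    by (simp add: int_chr_def pd_int_chr[OF x] nz, simp add: divide_simps nz,
        simp add: power2_eq_square algebra_simps)
  \<comment> \<open>The curvature of the unit sphere contributes a constant 1, which combines with
    the \<open>curv\<close> terms once \<open>curv\<close> is expanded; likewise in the last
    component.\<close>
  show "ricci (int_metric k a) 3 3 x =
      - (a (x$1) * a2 (x$1) + 2 * (a1 (x$1))\<^sup>2 + 2 * k) * (x$2)\<^sup>2"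
    unfolding unf
    by (simp add: int_chr_def pd_int_chr[OF x] nz, simp add: divide_simps nz,
        simp add: curv_def power2_eq_square algebra_simps)
  show "ricci (int_metric k a) 4 4 x =
      - (a (x$1) * a2 (x$1) + 2 * (a1 (x$1))\<^sup>2 + 2 * k) * (x$2)\<^sup>2 * (sin (x$3))\<^sup>2"
    unfolding unf
    by (simp add: int_chr_def pd_int_chr[OF x] nz)
      (simp add: curv_def power2_eq_square algebra_simps)
qed

lemma inv_int_metric:
  assumes "x \<in> chart"
  shows "inv_metric (int_metric k a) x $ i $ j = (if i = j then 1 / int_diag k a i x else 0)"
  by (rule inv_metric_diagonal) (simp_all add: int_metric_nth int_diag_nonzero[OF assms])

lemma ricci_scalar_int_metric:
  assumes x: "x \<in> chart"
  shows "ricci_scalar (int_metric k a) x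
    = 6 * (((a1 (x$1))\<^sup>2 + k) / (a (x$1))\<^sup>2 + a2 (x$1) / a (x$1))"
  unfolding ricci_scalar_def sum_4 inv_int_metric[OF x]
  by (simp add: ricci_int_metric[OF x] int_diag_simps chart_nonzero[OF x])
    (simp add: field_simps power2_eq_square chart_nonzero[OF x])

text \<open>A constant Ricci scalar makes \<open>f_R\<close> constant on the open chart, so its
  first and second derivatives vanish and the Hessian and box terms drop out. What remains is
  algebraic and can be traced.\<close>

lemma field_equations_trace:
  assumes x: "x \<in> chart"
    and const: "\<And>y. y \<in> chart \<Longrightarrow> ricci_scalar (int_metric k a) y = R0"
    and eqs: "fR_field_equations f I \<kappa> (int_metric k a)
       (dust_stress (int_metric k a) (\<lambda>x. \<rho>\<^sub>0 / a (x$1) ^ 3) (\<lambda>x. axis 1 1)) S" "x \<in> S"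
  shows "deriv f R0 * R0 - 2 * f R0 = - \<kappa> * (\<rho>\<^sub>0 / a (x$1) ^ 3)"
proof -
  let ?g = "int_metric k a"
  let ?F = "\<lambda>y. deriv f (ricci_scalar ?g y)"
  have F: "?F y = deriv f R0" if "y \<in> chart" for y
    using const[OF that] by simp
  have pd0: "pd \<mu> ?F y = 0" if "y \<in> chart" for \<mu> y
    using pd_cong_open[OF open_chart that, of ?F "\<lambda>_. deriv f R0" \<mu>] F by simp
  have pd00: "pd \<mu> (pd \<nu> ?F) x = 0" for \<mu> \<nu>
    using pd_cong_open[OF open_chart x, of "pd \<nu> ?F" "\<lambda>_. 0" \<mu>] pd0 by simp
  have hess: "hessian ?g ?F \<mu> \<nu> x = 0" for \<mu> \<nu>
    unfolding hessian_def pd00 pd0[OF x] by simp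
  have box: "box ?g ?F x = 0"
    unfolding box_def hess by simp
  have "lower ?g x (axis 1 1) $ \<mu> = (if \<mu> = 1 then 1 else 0)" for \<mu>
    by (simp add: lower_def matrix_vector_mult_basis column_def int_metric_nth int_diag_simps)
  then have eq: "deriv f R0 * ricci ?g \<mu> \<mu> x - 1/2 * f R0 * int_diag k a \<mu> x
      = (if \<mu> = 1 then - \<kappa> * (\<rho>\<^sub>0 / a (x$1) ^ 3) else 0)" for \<mu>
    using eqs(1)[unfolded fR_field_equations_def Let_def, rule_format, OF eqs(2), THEN conjunct2,
        rule_format, of \<mu> \<mu>]
    unfolding hess box const[OF x] dust_stress_def int_metric_nth by (simp split: if_splits)
  \<comment> \<open>Dividing each diagonal equation by its metric entry and adding is the
    contraction with the inverse metric. The dust enters only for \<mu> = 1, where the entry is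
    1.\<close>
  have "deriv f R0 * R0 = (\<Sum>\<mu>\<in>UNIV. (deriv f R0 * ricci ?g \<mu> \<mu> x) / int_diag k a \<mu> x)"
    unfolding const[OF x, symmetric] ricci_scalar_def inv_int_metric[OF x]
    by (simp add: if_distrib[of "\<lambda>u. u * _"] sum_distrib_left cong: if_cong)
  also have "\<dots> = (\<Sum>\<mu>\<in>(UNIV :: 4 set). 1/2 * f R0 + (if \<mu> = 1 then - \<kappa> * (\<rho>\<^sub>0 / a (x$1) ^ 3) else 0))"
  proof (rule sum.cong)
    fix \<mu> :: 4
    show "deriv f R0 * ricci ?g \<mu> \<mu> x / int_diag k a \<mu> x
      = 1/2 * f R0 + (if \<mu> = 1 then - \<kappa> * (\<rho>\<^sub>0 / a (x$1) ^ 3) else 0)"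
      using eq[of \<mu>] int_diag_nonzero[OF x, of \<mu>]
      by (cases "\<mu> = 1") (auto simp: field_simps int_diag_simps)
  qed simp
  also have "\<dots> = 2 * f R0 - \<kappa> * (\<rho>\<^sub>0 / a (x$1) ^ 3)"
    by (simp add: sum_4)
  finally show ?thesis by simp
qed


section \<open>Consequences of the junction conditions on the surface\<close>

text \<open>The radius comes from the angular part of the induced metric, the speed from the polar
  component of the extrinsic curvature. Only squares of normal components survive, so the
  orientations of the two normals do not matter.\<close>

lemma matched_surface:
  assumes m: "smoothly_matched k \<chi>\<^sub>s c a \<D> A B t\<^sub>s r\<^sub>s"
    and star: "\<chi>\<^sub>s > 0" "1 - k * \<chi>\<^sub>s\<^sup>2 > 0" and \<tau>: "0 < \<tau>" "\<tau> < c"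
    and ext: "\<And>t r. (t, r) \<in> \<D> \<Longrightarrow> r > 0 \<and> A t r > 0 \<and> B t r > 0"
  shows "r\<^sub>s \<tau> = a \<tau> * \<chi>\<^sub>s"
    and "(deriv r\<^sub>s \<tau>)\<^sup>2 = 1 - k * \<chi>\<^sub>s\<^sup>2 - 1 / B (t\<^sub>s \<tau>) (r\<^sub>s \<tau>)"
    and "ext_ricci_scalar A B (t\<^sub>s \<tau>) (r\<^sub>s \<tau>)
      = 6 * (((a1 \<tau>)\<^sup>2 + k) / (a \<tau>)\<^sup>2 + a2 \<tau> / a \<tau>)"
proof -
  \<comment> \<open>The angles agree with those at which \<open>ext_ricci_scalar\<close> is
    evaluated.\<close>
  define y :: "real^3" where "y = vector [\<tau>, pi / 2, 0]"
  define S where "S = {y :: real^3. 0 \<le> y$1 \<and> y$1 < c \<and> 0 < y$2 \<and> y$2 < pi}"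
  \<comment> \<open>Dropping \<tau> = 0 makes the parameter domain open, as differentiating the
    normal requires.\<close>
  define S0 where "S0 = {y :: real^3. 0 < y$1 \<and> y$1 < c \<and> 0 < y$2 \<and> y$2 < pi}"
  let ?gm = "int_metric k a" and ?Xm = "int_surface \<chi>\<^sub>s"
  let ?gp = "ext_metric A B" and ?Xp = "ext_surface t\<^sub>s r\<^sub>s"
  let ?t = "t\<^sub>s \<tau>" and ?r = "r\<^sub>s \<tau>"
  let ?A = "A ?t ?r" and ?B = "B ?t ?r"
  obtain nm np where nm: "unit_normal ?gm ?Xm S nm" and np: "unit_normal ?gp ?Xp S np"
    and J: "junction_conditions ?gm ?Xm nm ?gp ?Xp np S"
    using m unfolding smoothly_matched_def Let_def S_def[symmetric] by blast
  have "open S0"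
    unfolding S0_def by (intro open_Collect_conj open_Collect_less continuous_intros)
  moreover have "S0 \<subseteq> S"
    by (auto simp: S_def S0_def)
  moreover have y0: "y \<in> S0"
    using \<tau> by (simp add: S0_def y_def)
  ultimately have S: "open S0" "S0 \<subseteq> S" "y \<in> S0" "y \<in> S" by auto
  have xm: "?Xm y = vector [\<tau>, \<chi>\<^sub>s, pi / 2, 0]" and xp: "?Xp y = vector [?t, ?r, pi / 2, 0]"
    by (simp_all add: int_surface_def ext_surface_def y_def)
  have chart: "?Xm y \<in> chart"
    using \<tau> star by (simp add: xm chart_def)
  have a: "a \<tau> > 0"
    using a_pos \<tau> by blast
  have w: "curv k \<chi>\<^sub>s > 0"
    using star by (simp add: curv_def)
  have "(?t, ?r) \<in> \<D>"
    using m \<tau> by (simp add: smoothly_matched_def)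
  then have pos: "?r > 0" "?A > 0" "?B > 0"
    using ext by auto
  have dp: "ext_diag A B i (?Xp y) \<noteq> 0" for i
    using exhaust_4[of i] pos by (auto simp: ext_diag_simps xp)
  note inner_m = inner_g_diagonal[of ?gm "int_diag k a", OF int_metric_nth]
  note inner_p = inner_g_diagonal[of ?gp "ext_diag A B", OF ext_metric_nth]
  have h: "induced_metric ?gp ?Xp b b y = induced_metric ?gm ?Xm b b y" for b
    using J S(4) by (simp add: junction_conditions_def)
  show r: "?r = a \<tau> * \<chi>\<^sub>s"
  proof -
    have "?r\<^sup>2 = (a \<tau> * \<chi>\<^sub>s)\<^sup>2"
      using h[of 2] by (simp add: induced_metric_def inner_m inner_p sum_4 tangent_int_surface
          tangent_ext_surface xm xp int_diag_simps ext_diag_simps power_mult_distrib)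
    then show ?thesis
      using pos a star by simp
  qed
  have h1: "?A * (deriv t\<^sub>s \<tau>)\<^sup>2 = 1 + ?B * (deriv r\<^sub>s \<tau>)\<^sup>2"
    using h[of 1] unfolding induced_metric_def inner_m inner_p sum_4 tangent_int_surface
          tangent_ext_surface xm xp int_diag_simps ext_diag_simps
    by (simp add: y_def power2_eq_square algebra_simps)
  have orth_m: "inner_g ?gm (?Xm y) (nm y) (tangent ?Xm b y) = 0"
    and norm_m: "inner_g ?gm (?Xm y) (nm y) (nm y) = -1"
    and orth_p: "inner_g ?gp (?Xp y) (np y) (tangent ?Xp b y) = 0"
    and norm_p: "inner_g ?gp (?Xp y) (np y) (np y) = -1" for b
    using nm np S(4) by (auto simp: unit_normal_def)
  have nm0: "nm y $ 1 = 0" "nm y $ 3 = 0" "nm y $ 4 = 0"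
    using orth_m[of 1] orth_m[of 2] orth_m[of 3] a star
    unfolding inner_m sum_4 tangent_int_surface xm int_diag_simps by simp_all
  have nm2: "(a \<tau>)\<^sup>2 * (nm y $ 2)\<^sup>2 = curv k \<chi>\<^sub>s"
    using norm_m w unfolding inner_m sum_4 nm0 xm int_diag_simps
    by (simp add: field_simps power2_eq_square)
  have np0: "np y $ 3 = 0" "np y $ 4 = 0"
    using orth_p[of 2] orth_p[of 3] pos
    unfolding inner_p sum_4 tangent_ext_surface xp ext_diag_simps by simp_all
  have o: "?A * np y $ 1 * deriv t\<^sub>s \<tau> = ?B * np y $ 2 * deriv r\<^sub>s \<tau>"
    using orth_p[of 1]
    unfolding inner_p sum_4 tangent_ext_surface xp ext_diag_simps by (simp add: y_def)
  have np2: "?A * (np y $ 1)\<^sup>2 = ?B * (np y $ 2)\<^sup>2 - 1"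
    using norm_p unfolding inner_p sum_4 np0 xp ext_diag_simps
    by (simp add: power2_eq_square algebra_simps)
  \<comment> \<open>Squaring the orthogonality relation eliminates the time component of the normal
    and the time velocity, through \<open>np2\<close> and \<open>h1\<close>.\<close>
  have "(?A * (np y $ 1)\<^sup>2) * (?A * (deriv t\<^sub>s \<tau>)\<^sup>2) = (?A * np y $ 1 * deriv t\<^sub>s \<tau>)\<^sup>2"
    by (simp add: power2_eq_square)
  also have "\<dots> = ?B\<^sup>2 * (np y $ 2)\<^sup>2 * (deriv r\<^sub>s \<tau>)\<^sup>2"
    unfolding o by (simp add: power_mult_distrib)
  finally have "(?B * (np y $ 2)\<^sup>2 - 1) * (1 + ?B * (deriv r\<^sub>s \<tau>)\<^sup>2)
      = ?B\<^sup>2 * (np y $ 2)\<^sup>2 * (deriv r\<^sub>s \<tau>)\<^sup>2"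
    unfolding np2 h1 .
  then have nr: "?B * (np y $ 2)\<^sup>2 = 1 + ?B * (deriv r\<^sub>s \<tau>)\<^sup>2"
    by (simp add: algebra_simps power2_eq_square)
  have "extrinsic_curvature ?gm ?Xm nm 2 2 y = - \<chi>\<^sub>s * (a \<tau>)\<^sup>2 * nm y $ 2"
  proof -
    have t: "tangent ?Xm 2 z $ i = (if i = 3 then 1 else 0)" for z i
      unfolding tangent_int_surface using exhaust_4[of i] by auto
    show ?thesis
      unfolding extrinsic_curvature_polar[of ?gm "int_diag k a", OF int_metric_nth
          int_diag_nonzero[OF chart] nm S(1-3) t] pd_int_diag_3[OF chart] nm0
      by (simp add: xm)
  qed
  moreover have "extrinsic_curvature ?gp ?Xp np 2 2 y = - ?r * np y $ 2"
  proof -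
    have t: "tangent ?Xp 2 z $ i = (if i = 3 then 1 else 0)" for z i
      unfolding tangent_ext_surface using exhaust_4[of i] by auto
    have p: "pd i (ext_diag A B 3) (?Xp y) = (if i = 2 then - 2 * ?r else 0)" for i
    proof -
      have "deriv (\<lambda>u. - (u\<^sup>2)) ?r = - 2 * ?r"
        by (rule DERIV_imp_deriv) (auto intro!: derivative_eq_intros)
      then show ?thesis
        unfolding ext_diag_simps pd_comp_nth[where h="\<lambda>u. - (u\<^sup>2)"] by (simp add: xp)
    qed
    show ?thesis
      unfolding extrinsic_curvature_polar[of ?gp "ext_diag A B", OF ext_metric_nth dp np S(1-3) t] p
      by simp
  qed
  moreover have "extrinsic_curvature ?gp ?Xp np 2 2 y = extrinsic_curvature ?gm ?Xm nm 2 2 y"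
    using J S(4) by (simp add: junction_conditions_def)
  ultimately have "np y $ 2 = a \<tau> * nm y $ 2"
    using r a star by (simp add: power2_eq_square)
  \<comment> \<open>Both sides are \<open>?B * (np y $ 2)\<^sup>2\<close>, expressed once by the
    interior normal and once by the surface velocity.\<close>
  then have "?B * (1 - k * \<chi>\<^sub>s\<^sup>2) = 1 + ?B * (deriv r\<^sub>s \<tau>)\<^sup>2"
    using nm2 nr by (simp add: power_mult_distrib curv_def)
  then show "(deriv r\<^sub>s \<tau>)\<^sup>2 = 1 - k * \<chi>\<^sub>s\<^sup>2 - 1 / ?B"
    using pos by (simp add: field_simps)
  have "ext_ricci_scalar A B ?t ?r = ricci_scalar ?gm (?Xm y)"
    using J S(4) unfolding junction_conditions_def ext_ricci_scalar_def xp[symmetric] by blast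
  then show "ext_ricci_scalar A B ?t ?r = 6 * (((a1 \<tau>)\<^sup>2 + k) / (a \<tau>)\<^sup>2 + a2 \<tau> / a \<tau>)"
    unfolding ricci_scalar_int_metric[OF chart] by (simp add: xm)
qed

end

section \<open>The exterior Ricci scalar\<close>

text \<open>As \<open>V\<close> does not depend on time, neither does the radial velocity, and its
  derivative along the flow is \<open>- deriv V r / 2\<close>; condition (ii) then gives
  \<open>G\<close>. In (iii) only the radial derivative remains, with a positive
  coefficient.\<close>

lemma static_exterior_ricci_scalar:
  assumes \<D>: "open \<D>" "\<And>t r. (t, r) \<in> \<D> \<Longrightarrow> r > 0 \<and> U t r > 0 \<and> V r > 0"
    and V: "smooth_on (snd ` \<D>) V" and w: "1 - k * \<chi>\<^sub>s\<^sup>2 > 0"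
    and j: "junction_everywhere k \<chi>\<^sub>s \<D> (\<lambda>t r. U t r * V r) (\<lambda>t r. inverse (V r))"
    and G: "G = (\<lambda>r. 6 * ((1 - V r) / r\<^sup>2 - deriv V r / (2 * r)))"
    and p: "(t, r) \<in> \<D>" "V r < 1 - k * \<chi>\<^sub>s\<^sup>2"
  shows "ext_ricci_scalar (\<lambda>t r. U t r * V r) (\<lambda>t r. inverse (V r)) t r = G r"
    and "(G has_field_derivative 0) (at r)"
proof -
  let ?R = "ext_ricci_scalar (\<lambda>t r. U t r * V r) (\<lambda>t r. inverse (V r))"
  define w where "w = 1 - k * \<chi>\<^sub>s\<^sup>2"
  have V1: "(V has_field_derivative deriv V r) (at r)"
    and V2: "(deriv V has_field_derivative deriv (deriv V) r) (at r)" if "(t, r) \<in> \<D>" for t r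
    using smooth_on_deriv[OF V, of r] that by (force simp: image_iff)+
  have w0: "w > 0" and sw: "(sqrt w)\<^sup>2 = w"
    using w by (simp_all add: w_def)
  have inv: "1 / inverse x = x" for x :: real
    by (simp add: divide_inverse)
  have J: "(- sqrt (w - V r) \<noteq> 0 \<longrightarrow>
        ?R t r = 6 * (((- sqrt (w - V r))\<^sup>2 + 1 - w) / r\<^sup>2 +
          (sqrt w * sqrt (inverse (V r) / (U t r * V r)) * d_t (\<lambda>t s. - sqrt (w - V s)) t r
            + - sqrt (w - V r) * d_r (\<lambda>t s. - sqrt (w - V s)) t r) / r)) \<and>
      - sqrt (w - V r) / (U t r * V r) * d_t ?R t r
        + sqrt w * sqrt (inverse (V r) / (U t r * V r)) / inverse (V r) * d_r ?R t r = 0"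
    if "(t, r) \<in> \<D>" for t r
    using bspec[OF j[unfolded junction_everywhere_def Let_def, folded w_def, unfolded sw inv] that,
        unfolded split_conv] by blast
  have R: "?R t r = G r" if p: "(t, r) \<in> \<D>" "V r < w" for t r
  proof -
    have dr: "d_r (\<lambda>t s. - sqrt (w - V s)) t r = deriv V r / (2 * sqrt (w - V r))"
      unfolding d_r_def using p
      by (intro DERIV_imp_deriv) (auto intro!: derivative_eq_intros V1[OF p(1)] simp: field_simps)
    have dt: "d_t (\<lambda>t s. - sqrt (w - V s)) t r = 0"
      by (simp add: d_t_def)
    have sq: "(- sqrt (w - V r))\<^sup>2 = w - V r"
      using p by simp
    have "- sqrt (w - V r) * (deriv V r / (2 * sqrt (w - V r))) = - (deriv V r / 2)"
      using p by simp
    moreover have "- sqrt (w - V r) \<noteq> 0"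
      using p by simp
    ultimately show ?thesis
      using J[OF p(1)] unfolding sq dr dt by (simp add: G)
  qed
  show "?R t r = G r"
    using R p by (simp add: w_def)
  \<comment> \<open>\<open>deriv\<close> is total, so \<open>deriv G r = 0\<close> alone would not
    make \<open>G\<close> differentiable.\<close>
  have GD: "\<exists>g. (G has_field_derivative g) (at r)"
    unfolding G using \<D>(2)[OF p(1)]
    by (intro exI) (auto intro!: derivative_eq_intros V1[OF p(1)] V2[OF p(1)])
  have "continuous_on (snd ` \<D>) V"
  proof (intro continuous_at_imp_continuous_on ballI)
    fix x assume "x \<in> snd ` \<D>"
    then obtain s where "(s, x) \<in> \<D>" by auto
    then show "isCont V x" by (rule DERIV_isCont[OF V1])
  qed
  then have "continuous_on \<D> (\<lambda>x. V (snd x))"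
    by (rule continuous_on_compose2) (auto intro: continuous_on_snd continuous_on_id)
  \<comment> \<open>A product neighbourhood inside this open region lets \<open>R\<close> be
    differentiated along both coordinate lines.\<close>
  then have "open (\<D> \<inter> (\<lambda>x. V (snd x)) -` {..<w})"
    using \<D>(1) by (rule continuous_open_preimage) simp
  moreover have "(t, r) \<in> \<D> \<inter> (\<lambda>x. V (snd x)) -` {..<w}"
    using p by (simp add: w_def)
  ultimately obtain T S where TS: "open T" "open S" "t \<in> T" "r \<in> S"
      "T \<times> S \<subseteq> \<D> \<inter> (\<lambda>x. V (snd x)) -` {..<w}"
    by (rule open_prod_elim) auto
  have "d_t ?R t r = deriv (\<lambda>s. G r) t"
    unfolding d_t_def
  proof (rule deriv_cong_ev)
    show "\<forall>\<^sub>F s in nhds t. ?R s r = G r"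
      using eventually_nhds_in_open[OF TS(1,3)] by eventually_elim (rule R; use TS in auto)
  qed simp
  moreover have "d_r ?R t r = deriv G r"
    unfolding d_r_def
  proof (rule deriv_cong_ev)
    show "\<forall>\<^sub>F s in nhds r. ?R t s = G s"
      using eventually_nhds_in_open[OF TS(2,4)] by eventually_elim (rule R; use TS in auto)
  qed simp
  ultimately have "deriv G r = 0"
    using J[OF p(1), THEN conjunct2] \<D>(2)[OF p(1)] w0 by simp
  then show "(G has_field_derivative 0) (at r)"
    using GD DERIV_imp_deriv by metis
qed

section \<open>Constancy along the surface and the contradiction\<close>

theorem mainTheorem4:
  fixes f a :: "real \<Rightarrow> real" and I :: "real set" and \<kappa> k \<rho>\<^sub>0 \<chi>\<^sub>s \<tau>\<^sub>c :: real
  assumes "fR_model f I"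
    and "\<forall>x\<in>I. deriv (deriv f) x \<noteq> 0"
    and "\<kappa> > 0"
    and "collapsing_dust_star f I \<kappa> k \<rho>\<^sub>0 \<chi>\<^sub>s \<tau>\<^sub>c a"
  shows "\<not> (\<exists>(U :: real \<Rightarrow> real \<Rightarrow> real) (V :: real \<Rightarrow> real) \<D> t\<^sub>s r\<^sub>s.
            smooth_on \<D> (\<lambda>(t, r). U t r) \<and> smooth_on (snd ` \<D>) V \<and>
            (\<forall>(t, r)\<in>\<D>. U t r > 0 \<and> V r > 0) \<and>
            (let A = (\<lambda>t r. U t r * V r); B = (\<lambda>t r. inverse (V r)) in
               vacuum_exterior f I \<kappa> \<D> A B \<and>
               smoothly_matched k \<chi>\<^sub>s \<tau>\<^sub>c a \<D> A B t\<^sub>s r\<^sub>s \<and>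
               junction_everywhere k \<chi>\<^sub>s \<D> A B))"
proof (intro notI, elim exE conjE)
  fix U :: "real \<Rightarrow> real \<Rightarrow> real" and V :: "real \<Rightarrow> real" and \<D> t\<^sub>s r\<^sub>s
  assume V: "smooth_on (snd ` \<D>) V" and UV: "\<forall>(t, r)\<in>\<D>. U t r > 0 \<and> V r > 0"
  define A B where "A = (\<lambda>t r. U t r * V r)" and "B = (\<lambda>(t :: real) r. inverse (V r))"
  assume "let A = (\<lambda>t r. U t r * V r); B = (\<lambda>t r. inverse (V r)) in
      vacuum_exterior f I \<kappa> \<D> A B \<and> smoothly_matched k \<chi>\<^sub>s \<tau>\<^sub>c a \<D> A B t\<^sub>s r\<^sub>s \<and>
      junction_everywhere k \<chi>\<^sub>s \<D> A B"
  then have vac: "vacuum_exterior f I \<kappa> \<D> A B" and m: "smoothly_matched k \<chi>\<^sub>s \<tau>\<^sub>c a \<D> A B t\<^sub>s r\<^sub>s"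
    and j: "junction_everywhere k \<chi>\<^sub>s \<D> A B"
    unfolding Let_def A_def B_def by blast+
  define G where "G = (\<lambda>r. 6 * ((1 - V r) / r\<^sup>2 - deriv V r / (2 * r)))"
  have star: "\<rho>\<^sub>0 > 0" "\<chi>\<^sub>s > 0" "1 - k * \<chi>\<^sub>s\<^sup>2 > 0" "\<tau>\<^sub>c > 0"
    and a: "smooth_on {0..<\<tau>\<^sub>c} a" and a_pos: "\<And>\<tau>. 0 < \<tau> \<Longrightarrow> \<tau> < \<tau>\<^sub>c \<Longrightarrow> a \<tau> > 0"
    and a_neg: "\<And>\<tau>. 0 < \<tau> \<Longrightarrow> \<tau> < \<tau>\<^sub>c \<Longrightarrow> deriv a \<tau> < 0"
    and eqs: "fR_field_equations f I \<kappa> (int_metric k a)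
       (dust_stress (int_metric k a) (\<lambda>x. \<rho>\<^sub>0 / a (x$1) ^ 3) (\<lambda>x. axis 1 1))
       {x. 0 \<le> x$1 \<and> x$1 < \<tau>\<^sub>c \<and> 0 < x$2 \<and> x$2 \<le> \<chi>\<^sub>s \<and> 0 < x$3 \<and> x$3 < pi}"
    using assms(4) by (simp_all add: collapsing_dust_star_def)
  interpret frw k \<tau>\<^sub>c a "deriv a" "deriv (deriv a)"
    by unfold_locales (use a_pos smooth_on_deriv[OF a] in auto)
  have \<D>: "r > 0 \<and> U t r > 0 \<and> V r > 0" "r > 0 \<and> A t r > 0 \<and> B t r > 0"
    if "(t, r) \<in> \<D>" for t r
    using vac UV that by (auto simp: vacuum_exterior_def)
  have on_\<D>: "(t\<^sub>s \<tau>, r\<^sub>s \<tau>) \<in> \<D>" if "0 < \<tau>" "\<tau> < \<tau>\<^sub>c" for \<tau>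
    using m that by (simp add: smoothly_matched_def)
  have "open \<D>"
    using vac by (simp add: vacuum_exterior_def)
  note surface = matched_surface[OF m star(2,3) _ _ \<D>(2)]
  have dr: "(r\<^sub>s has_field_derivative deriv a \<tau> * \<chi>\<^sub>s) (at \<tau>)" if "0 < \<tau>" "\<tau> < \<tau>\<^sub>c" for \<tau>
  proof (rule has_field_derivative_transform_within_open)
    show "((\<lambda>s. a s * \<chi>\<^sub>s) has_field_derivative deriv a \<tau> * \<chi>\<^sub>s) (at \<tau>)"
      using a_deriv[OF that] by (rule DERIV_cmult_right)
    show "a s * \<chi>\<^sub>s = r\<^sub>s s" if "s \<in> {0<..<\<tau>\<^sub>c}" for s
      using surface(1)[of s] that by auto
  qed (use that in auto)
  have V_less: "V (r\<^sub>s \<tau>) < 1 - k * \<chi>\<^sub>s\<^sup>2" if "0 < \<tau>" "\<tau> < \<tau>\<^sub>c" for \<tau>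
  proof -
    have "deriv r\<^sub>s \<tau> \<noteq> 0"
      using DERIV_imp_deriv[OF dr[OF that]] a_neg[OF that] star(2) by simp
    then have "(deriv r\<^sub>s \<tau>)\<^sup>2 > 0"
      by simp
    then show ?thesis
      using surface(2)[OF that] by (simp add: B_def divide_inverse)
  qed
  have ext: "ext_ricci_scalar A B (t\<^sub>s \<tau>) (r\<^sub>s \<tau>) = G (r\<^sub>s \<tau>)"
      "(G has_field_derivative 0) (at (r\<^sub>s \<tau>))" if "0 < \<tau>" "\<tau> < \<tau>\<^sub>c" for \<tau>
    using static_exterior_ricci_scalar[OF \<open>open \<D>\<close> \<D>(1) V star(3) j[unfolded A_def B_def] G_def
      on_\<D>[OF that] V_less[OF that]] unfolding A_def B_def by blast+
  define R0 where "R0 = G (r\<^sub>s (\<tau>\<^sub>c / 2))"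
  \<comment> \<open>Constancy is derived in \<tau>, which runs over an interval, because
    \<open>\<D>\<close> is not assumed connected.\<close>
  have G_const: "G (r\<^sub>s \<tau>) = R0" if "0 < \<tau>" "\<tau> < \<tau>\<^sub>c" for \<tau>
  proof -
    have "((\<lambda>\<tau>. G (r\<^sub>s \<tau>)) has_field_derivative 0) (at s)" if "s \<in> {0<..<\<tau>\<^sub>c}" for s
      using DERIV_chain2[OF ext(2) dr, of s] that by simp
    then show ?thesis
      unfolding R0_def
      using DERIV_isconst3[of 0 \<tau>\<^sub>c \<tau> "\<tau>\<^sub>c / 2" "\<lambda>\<tau>. G (r\<^sub>s \<tau>)"] that star by simp
  qed
  \<comment> \<open>The interior scalar depends on \<open>y$1\<close> alone, so its surface value at
    that time holds at every radius.\<close>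
  have R_const: "ricci_scalar (int_metric k a) y = R0" if "y \<in> chart" for y
    using ricci_scalar_int_metric[OF that] surface(3)[of "y$1"] ext(1)[of "y$1"]
      G_const[of "y$1"] chartD[OF that] by simp
  have a3: "deriv f R0 * R0 - 2 * f R0 = - \<kappa> * (\<rho>\<^sub>0 / a \<tau> ^ 3)" if "0 < \<tau>" "\<tau> < \<tau>\<^sub>c" for \<tau>
  proof -
    have "vector [\<tau>, \<chi>\<^sub>s, pi / 2, 0] \<in> chart"
      using that star by (simp add: chart_def)
    then show ?thesis
      using field_equations_trace[OF _ R_const eqs, of "vector [\<tau>, \<chi>\<^sub>s, pi / 2, 0]"] that star
      by simp
  qed
  \<comment> \<open>Any two distinct times during the collapse would serve: the left side of
    \<open>a3\<close> does not depend on \<tau>.\<close>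
  have "\<rho>\<^sub>0 / a (\<tau>\<^sub>c / 3) ^ 3 = \<rho>\<^sub>0 / a (\<tau>\<^sub>c / 2) ^ 3"
    using a3[of "\<tau>\<^sub>c / 3"] a3[of "\<tau>\<^sub>c / 2"] star assms(3) by simp
  then have "a (\<tau>\<^sub>c / 3) ^ 3 = a (\<tau>\<^sub>c / 2) ^ 3"
    using star a_pos[of "\<tau>\<^sub>c / 3"] a_pos[of "\<tau>\<^sub>c / 2"] by (simp add: field_simps)
  then have "a (\<tau>\<^sub>c / 3) = a (\<tau>\<^sub>c / 2)"
    using star a_pos[of "\<tau>\<^sub>c / 3"] a_pos[of "\<tau>\<^sub>c / 2"] by (simp add: power_eq_iff_eq_base)
  moreover have "a (\<tau>\<^sub>c / 2) < a (\<tau>\<^sub>c / 3)"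
  proof (rule DERIV_neg_imp_decreasing[where f=a])
    fix x assume "\<tau>\<^sub>c / 3 \<le> x" "x \<le> \<tau>\<^sub>c / 2"
    then have "0 < x" "x < \<tau>\<^sub>c"
      using star by auto
    then show "\<exists>y. (a has_field_derivative y) (at x) \<and> y < 0"
      using a_deriv a_neg by blast
  qed (use star in simp)
  ultimately show False by simp
qed

end
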